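(* Let $n,t\ge1$ be integers and assume that $\rho_{AB}\in\mathrm{DPS}^{(t)}_n$ with $\mathrm{DPS}^{(t)}$-certificate $\rho_{AB[t]}$. Then $\Pi_{\mathrm{LDUI}_n}(\rho_{AB})\in\mathrm{DPS}^{(t)}_n$ with $\mathrm{DPS}^{(t)}$-certificate $\Pi_{\mathrm{LDUI}^{(t)}_n}(\rho_{AB[t]})$, and $\Pi_{\mathrm{LDOI}_n}(\rho_{AB})\in\mathrm{DPS}^{(t)}_n$ with $\mathrm{DPS}^{(t)}$-certificate $\Pi_{\mathrm{LDOI}^{(t)}_n}(\rho_{AB[t]})$.
   Context: $\mathrm{Herm}(V)$ denotes the Hermitian matrices acting on $V$. Matrices in $\mathrm{Herm}(\mathbb C^n\otimes(\mathbb C^n)^{\otimes t})$ are indexed by sequences $i_0\underline i$ with $i_0\in[n]$, $\underline i=i_1\ldots i_t\in[n]^t$. For $\sigma\in\mathfrak S_t$, $\underline i^\sigma=i_{\sigma(1)}\ldots i_{\sigma(t)}$. For $\rho\in\mathrm{Herm}(\mathbb C^n\otimes(\mathbb C^n)^{\otimes t})$ and $0\le s\le t$, the partial transpose $\rho^{T_{B[s]}}$ has entries $(\rho^{T_{B[s]}})_{i_0\underline h\,\underline i,\ j_0\underline k\,\underline j}=\rho_{i_0\underline k\,\underline i,\ j_0\underline h\,\underline j}$ for $i_0,j_0\in[n]$, $\underline h,\underline k\in[n]^s$, $\underline i,\underline j\in[n]^{t-s}$. The partial trace is $(\mathrm{Tr}_{B[2:t]}(\rho))_{ij,kl}=\sum_{\underline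 h\in[n]^{t-1}}\rho_{ij\underline h,\,kl\underline h}$. A $\mathrm{DPS}^{(t)}$-certificate for $\rho_{AB}\in\mathrm{Herm}(\mathbb C^n\otimes\mathbb C^n)$ is a matrix $\rho_{AB[t]}\in\mathrm{Herm}(\mathbb C^n\otimes(\mathbb C^n)^{\otimes t})$ such that: (1) $(\rho_{AB[t]})_{i_0\underline i,j_0\underline j}=(\rho_{AB[t]})_{i_0\underline i,j_0\underline j^\sigma}$ for all $\sigma\in\mathfrak S_t$ and all indices; (2) $\rho_{AB[t]}^{T_{B[s]}}\succeq 0$ for all $s=0,1,\ldots,t$; (3) $\mathrm{Tr}_{B[2:t]}(\rho_{AB[t]})=\rho_{AB}$. $\mathrm{DPS}^{(t)}_n$ is the set of $\rho_{AB}$ having a $\mathrm{DPS}^{(t)}$-certificate. $\mathcal{DU}_n$ is the group of diagonal unitary $n\times n$ matrices and $\mathcal{DO}_n$ is the group of diagonal matrices with diagonal entries in $\{\pm1\}$. $\mathrm{LDUI}^{(t)}_n$ (resp. $\mathrm{LDOI}^{(t)}_n$) is the set of $\rho\in\mathrm{Herm}(\mathbb C^n\otimes(\mathbb C^n)^{\otimes t})$ with $\rho=(U\otimes U^{\otimes t})\rho(U\otimes U^{\otimes t})^*$ for all $U\in\mathcal{DU}_n$ (resp. all $U\in\mathcal{DO}_n$). The projections are $\Pi_{\mathrm{LDUI}^{(t)}_n}(\rho)=\int_{\mathcal{DU}_n}(U\otimes U^{\otimes t})\rho(U\otimes U^{\otimes t})^*dU$ (Haar probability measure) and $\Pi_{\mathrm{LDOI}^{(t)}_n}(\rho)=\frac1{2^n}\sum_{O\in\mathcal{DO}_n}(O\otimes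 O^{\otimes t})\rho(O\otimes O^{\otimes t})^*$. For $t=1$ the superscript is omitted: $\Pi_{\mathrm{LDUI}_n}=\Pi_{\mathrm{LDUI}^{(1)}_n}$, $\Pi_{\mathrm{LDOI}_n}=\Pi_{\mathrm{LDOI}^{(1)}_n}$. *)

theory Defs
  imports "HOL-Probability.Probability" "HOL-Combinatorics.Permutations"
begin

section \<open>Matrices indexed by sequences\<close>

text \<open>
  The index set \<open>[n]\<close> is an arbitrary finite type \<^typ>\<open>'n\<close> (so \<open>n = CARD('n) \<ge> 1\<close>).
  A matrix acting on \<open>\<complex>\<^sup>n \<otimes> (\<complex>\<^sup>n)\<^sup>\<otimes>\<^sup>t\<close> is a function of two lists of length \<open>t + 1\<close>, the
  sequence \<open>i\<^sub>0 i\<^sub>1 \<dots> i\<^sub>t\<close> being \<open>i0 # [i1, \<dots>, it]\<close>. All such matrices vanish on other lists, so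
  that equality of matrices is equality of functions.
\<close>

type_synonym 'n seqmat = "'n list \<Rightarrow> 'n list \<Rightarrow> complex"

definition seqs :: "nat \<Rightarrow> 'n list set" where
  "seqs t = {I. length I = Suc t}"

definition seqmat :: "nat \<Rightarrow> 'n seqmat set" where
  "seqmat t = {A. \<forall>I J. \<not> (I \<in> seqs t \<and> J \<in> seqs t) \<longrightarrow> A I J = 0}"

definition seqmat_mult :: "nat \<Rightarrow> 'n seqmat \<Rightarrow> 'n seqmat \<Rightarrow> 'n seqmat" where
  "seqmat_mult t A B = (\<lambda>I J. \<Sum>K\<in>seqs t. A I K * B K J)"

definition seqmat_adjoint :: "'n seqmat \<Rightarrow> 'n seqmat" where
  "seqmat_adjoint A = (\<lambda>I J. cnj (A J I))"

definition Herm :: "nat \<Rightarrow> 'n seqmat set" where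
  "Herm t = {A \<in> seqmat t. seqmat_adjoint A = A}"

definition psd :: "nat \<Rightarrow> 'n seqmat \<Rightarrow> bool" where
  "psd t A \<longleftrightarrow> A \<in> Herm t \<and>
     (\<forall>x. 0 \<le> Re (\<Sum>I\<in>seqs t. \<Sum>J\<in>seqs t. cnj (x I) * A I J * x J))"

section \<open>The DPS hierarchy\<close>

text \<open>
  In a sequence \<open>I\<close>, \<open>hd I\<close> is the \<open>A\<close>-index and \<open>take s (tl I)\<close> holds the indices of \<open>B[s]\<close>.
\<close>

definition partial_transpose :: "nat \<Rightarrow> nat \<Rightarrow> 'n seqmat \<Rightarrow> 'n seqmat" where
  "partial_transpose t s \<rho> = (\<lambda>I J. if I \<in> seqs t \<and> J \<in> seqs t
     then \<rho> (hd I # take s (tl J) @ drop s (tl I)) (hd J # take s (tl I) @ drop s (tl J))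
     else 0)"

lemma partial_transpose_entry:
  assumes "length h = s" "length k = s" "length i = t - s" "length j = t - s" "s \<le> t"
  shows "partial_transpose t s \<rho> (i0 # h @ i) (j0 # k @ j) = \<rho> (i0 # k @ i) (j0 # h @ j)"
  using assms by (simp add: partial_transpose_def seqs_def)

definition partial_trace :: "nat \<Rightarrow> 'n seqmat \<Rightarrow> 'n seqmat" where
  "partial_trace t \<rho> = (\<lambda>I J. if I \<in> seqs 1 \<and> J \<in> seqs 1
     then \<Sum>h | length h = t - 1. \<rho> (I @ h) (J @ h) else 0)"

lemma partial_trace_entry:
  "partial_trace t \<rho> [i, j] [k, l] = (\<Sum>h | length h = t - 1. \<rho> (i # j # h) (k # l # h))"
  by (simp add: partial_trace_def seqs_def)

definition DPS_certificate :: "nat \<Rightarrow> 'n seqmat \<Rightarrow> 'n seqmat \<Rightarrow> bool" where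
  "DPS_certificate t \<rho>AB \<rho> \<longleftrightarrow> \<rho>AB \<in> Herm 1 \<and> \<rho> \<in> Herm t \<and>
     (\<forall>\<sigma>. \<sigma> permutes {..<t} \<longrightarrow>
        (\<forall>i0 j0 is js. length is = t \<longrightarrow> length js = t \<longrightarrow>
           \<rho> (i0 # is) (j0 # js) = \<rho> (i0 # is) (j0 # permute_list \<sigma> js))) \<and>
     (\<forall>s\<le>t. psd t (partial_transpose t s \<rho>)) \<and>
     partial_trace t \<rho> = \<rho>AB"

definition DPS :: "nat \<Rightarrow> 'n seqmat set" where
  "DPS t = {\<rho>AB \<in> Herm 1. \<exists>\<rho>. DPS_certificate t \<rho>AB \<rho>}"

section \<open>Diagonal unitary and diagonal sign matrices\<close>

definition diagonal :: "complex^'n^'n \<Rightarrow> bool" where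
  "diagonal U \<longleftrightarrow> (\<forall>i j. i \<noteq> j \<longrightarrow> U $ i $ j = 0)"

definition conj_transpose :: "complex^'n^'n \<Rightarrow> complex^'n^'n" where
  "conj_transpose U = (\<chi> i j. cnj (U $ j $ i))"

definition DU :: "(complex^'n^'n) set" where
  "DU = {U. diagonal U \<and> U ** conj_transpose U = mat 1 \<and> conj_transpose U ** U = mat 1}"

definition DO :: "(complex^'n^'n) set" where
  "DO = {U. diagonal U \<and> (\<forall>i. U $ i $ i \<in> {1, -1})}"

definition is_haar_DU :: "(complex^'n^'n) measure \<Rightarrow> bool" where
  "is_haar_DU M \<longleftrightarrow> prob_space M \<and> sets M = sets (restrict_space borel DU) \<and>
     (\<forall>U\<in>DU. distr M M (\<lambda>V. U ** V) = M)"

text \<open>Existence and uniqueness are proved below, in \<open>ex1_haar_DU\<close>.\<close>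

definition haar_DU :: "(complex^'n^'n) measure" where
  "haar_DU = (THE M. is_haar_DU M)"

section \<open>Projections\<close>

text \<open>The matrix \<open>U \<otimes> U\<^sup>\<otimes>\<^sup>t\<close>.\<close>

definition tensor_pow :: "nat \<Rightarrow> complex^'n^'n \<Rightarrow> 'n seqmat" where
  "tensor_pow t U = (\<lambda>I J. if I \<in> seqs t \<and> J \<in> seqs t
     then \<Prod>k\<le>t. U $ (I ! k) $ (J ! k) else 0)"

definition local_conj :: "nat \<Rightarrow> complex^'n^'n \<Rightarrow> 'n seqmat \<Rightarrow> 'n seqmat" where
  "local_conj t U \<rho> =
     seqmat_mult t (seqmat_mult t (tensor_pow t U) \<rho>) (seqmat_adjoint (tensor_pow t U))"

definition proj_LDUI :: "nat \<Rightarrow> 'n::finite seqmat \<Rightarrow> 'n seqmat" where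
  "proj_LDUI t \<rho> = (\<lambda>I J. \<integral>U. local_conj t U \<rho> I J \<partial>haar_DU)"

definition proj_LDOI :: "nat \<Rightarrow> 'n::finite seqmat \<Rightarrow> 'n seqmat" where
  "proj_LDOI t \<rho> = (\<lambda>I J. 1 / 2 ^ CARD('n) * (\<Sum>U\<in>DO. local_conj t U \<rho> I J))"

section \<open>Existence and uniqueness of the Haar probability measure\<close>

lemma diagonal_mult:
  fixes U V :: "complex^'n^'n"
  assumes "diagonal U" "diagonal V"
  shows "U ** V = (\<chi> i j. if i = j then U $ i $ i * V $ i $ i else 0)"
proof -
  have "(\<Sum>k\<in>UNIV. U $ i $ k * V $ k $ j) = (if i = j then U $ i $ i * V $ i $ i else 0)" for i j
  proof -
    have "(\<Sum>k\<in>UNIV. U $ i $ k * V $ k $ j)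
        = (\<Sum>k\<in>UNIV. if k = i then U $ i $ i * V $ i $ j else 0)"
      using assms(1) by (intro sum.cong) (auto simp: diagonal_def)
    then show ?thesis
      using assms(2) by (simp add: diagonal_def)
  qed
  then show ?thesis
    by (simp add: matrix_matrix_mult_def vec_eq_iff)
qed

lemma DU_iff: "U \<in> DU \<longleftrightarrow> diagonal U \<and> (\<forall>i. cmod (U $ i $ i) = 1)"
proof (cases "diagonal U")
  case True
  then have ad: "diagonal (conj_transpose U)"
    by (auto simp: diagonal_def conj_transpose_def)
  have *: "z * cnj z = 1 \<longleftrightarrow> cmod z = 1" for z
  proof -
    have "z * cnj z = 1 \<longleftrightarrow> complex_of_real ((cmod z)\<^sup>2) = complex_of_real 1"
      by (simp only: complex_norm_square of_real_1)
    also have "\<dots> \<longleftrightarrow> cmod z = 1"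
      by (simp only: of_real_eq_iff power2_eq_1_iff) (use norm_ge_zero[of z] in linarith)
    finally show ?thesis .
  qed
  have "U ** conj_transpose U = mat 1 \<longleftrightarrow> (\<forall>i. U $ i $ i * cnj (U $ i $ i) = 1)"
    unfolding diagonal_mult[OF True ad] by (auto simp: vec_eq_iff mat_def conj_transpose_def)
  moreover have "conj_transpose U ** U = mat 1 \<longleftrightarrow> (\<forall>i. U $ i $ i * cnj (U $ i $ i) = 1)"
    unfolding diagonal_mult[OF ad True]
    by (auto simp: vec_eq_iff mat_def conj_transpose_def mult.commute)
  ultimately show ?thesis using True by (simp add: DU_def *)
qed (auto simp: DU_def)

lemma DU_mult: "U \<in> DU \<Longrightarrow> V \<in> DU \<Longrightarrow> U ** V \<in> DU"
  by (auto simp: DU_iff diagonal_mult norm_mult) (auto simp: diagonal_def)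

lemma DU_commute: "U \<in> DU \<Longrightarrow> V \<in> DU \<Longrightarrow> U ** V = V ** U"
  by (auto simp: DU_iff diagonal_mult vec_eq_iff)

lemma measurable_DU_mult:
  "(\<lambda>(U, V). (U :: complex^'n^'n) ** V) \<in>
     restrict_space borel DU \<Otimes>\<^sub>M restrict_space borel DU \<rightarrow>\<^sub>M restrict_space borel DU"
  (is "_ \<in> ?P \<rightarrow>\<^sub>M _")
proof (rule measurable_restrict_space2)
  have id: "(\<lambda>U. U) \<in> restrict_space borel DU \<rightarrow>\<^sub>M borel"
    by (simp add: measurable_restrict_space1)
  have m: "fst \<in> ?P \<rightarrow>\<^sub>M borel" "snd \<in> ?P \<rightarrow>\<^sub>M borel"
    by (rule measurable_compose[OF measurable_fst id], rule measurable_compose[OF measurable_snd id])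
  have "continuous_on UNIV (\<lambda>x::(complex^'n^'n) \<times> (complex^'n^'n). fst x ** snd x)"
    unfolding matrix_matrix_mult_def by (intro continuous_intros)
  from borel_measurable_continuous_Pair[OF m this]
  show "(\<lambda>(U, V). U ** V) \<in> ?P \<rightarrow>\<^sub>M borel"
    by (simp add: case_prod_unfold)
qed (auto simp: space_pair_measure space_restrict_space intro: DU_mult)

lemma is_haar_DU_unique:
  fixes M N :: "(complex^'n^'n) measure"
  assumes "is_haar_DU M" "is_haar_DU N"
  shows "M = N"
proof (rule measure_eqI)
  let ?R = "restrict_space borel DU :: (complex^'n^'n) measure"
  have sM [measurable_cong]: "sets M = sets ?R" and sN [measurable_cong]: "sets N = sets ?R"
    and invM: "\<And>U. U \<in> DU \<Longrightarrow> distr M M (\<lambda>V. U ** V) = M"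
    and invN: "\<And>U. U \<in> DU \<Longrightarrow> distr N N (\<lambda>V. U ** V) = N"
    using assms by (auto simp: is_haar_DU_def)
  interpret M: prob_space M using assms by (simp add: is_haar_DU_def)
  interpret N: prob_space N using assms by (simp add: is_haar_DU_def)
  interpret MN: pair_prob_space M N ..
  have spM: "space M = DU" and spN: "space N = DU"
    using sets_eq_imp_space_eq[OF sM] sets_eq_imp_space_eq[OF sN]
    by (auto simp: space_restrict_space)
  show "sets M = sets N" by (simp add: sM sN)
  fix A assume "A \<in> sets M"
  then have A: "A \<in> sets ?R" by (simp add: sM)
  have mult: "(\<lambda>V. U ** V) \<in> ?R \<rightarrow>\<^sub>M ?R" if "U \<in> DU" for U
    using measurable_compose[OF measurable_Pair1' measurable_DU_mult, of U] that
    by (simp add: space_restrict_space)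
  have eM: "(\<integral>\<^sup>+V. indicator A (U ** V) \<partial>M) = emeasure M A" if "U \<in> DU" for U
  proof -
    have "(\<integral>\<^sup>+V. indicator A (U ** V) \<partial>M) = (\<integral>\<^sup>+V. indicator A V \<partial>distr M M (\<lambda>V. U ** V))"
      using mult[OF that] A
      by (subst nn_integral_distr) (auto simp: sM cong: measurable_cong_sets)
    then show ?thesis using A by (simp add: invM[OF that] sM)
  qed
  have eN: "(\<integral>\<^sup>+V. indicator A (U ** V) \<partial>N) = emeasure N A" if "U \<in> DU" for U
  proof -
    have "(\<integral>\<^sup>+V. indicator A (U ** V) \<partial>N) = (\<integral>\<^sup>+V. indicator A V \<partial>distr N N (\<lambda>V. U ** V))"
      using mult[OF that] A
      by (subst nn_integral_distr) (auto simp: sN cong: measurable_cong_sets)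
    then show ?thesis using A by (simp add: invN[OF that] sN)
  qed
  have meas: "(\<lambda>(U, V). indicator A (U ** V) :: ennreal) \<in> borel_measurable (M \<Otimes>\<^sub>M N)"
  proof -
    have "(\<lambda>(U, V). U ** V) \<in> M \<Otimes>\<^sub>M N \<rightarrow>\<^sub>M ?R"
      using measurable_DU_mult sM sN
      by (subst measurable_cong_sets[OF sets_pair_measure_cong[OF sM sN] refl])
    from measurable_compose[OF this borel_measurable_indicator[OF A]]
    show ?thesis by (simp add: case_prod_unfold)
  qed
  have "emeasure M A = (\<integral>\<^sup>+V. emeasure M A \<partial>N)"
    by (simp add: N.emeasure_space_1)
  also have "\<dots> = (\<integral>\<^sup>+V. \<integral>\<^sup>+U. indicator A (U ** V) \<partial>M \<partial>N)"
    by (intro nn_integral_cong, subst eM[symmetric])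
      (auto simp: spN spM intro!: nn_integral_cong simp: DU_commute)
  also have "\<dots> = (\<integral>\<^sup>+U. \<integral>\<^sup>+V. indicator A (U ** V) \<partial>N \<partial>M)"
    using MN.Fubini'[OF meas] by simp
  also have "\<dots> = (\<integral>\<^sup>+U. emeasure N A \<partial>M)"
    by (intro nn_integral_cong) (simp add: eN spM)
  also have "\<dots> = emeasure N A"
    by (simp add: M.emeasure_space_1)
  finally show "emeasure M A = emeasure N A" .
qed

definition unit_measure :: "real measure" where
  "unit_measure = uniform_measure lborel {0..<1}"

lemma sets_unit_measure [simp, measurable_cong]: "sets unit_measure = sets borel"
  by (simp add: unit_measure_def)

lemma prob_space_unit_measure: "prob_space unit_measure"
  unfolding unit_measure_def by (rule prob_space_uniform_measure) auto

lemma measurable_frac_shift: "(\<lambda>x::real. frac (x + c)) \<in> borel \<rightarrow>\<^sub>M borel"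
  unfolding frac_def by measurable

lemma unit_measure_shift:
  assumes A: "A \<in> sets borel"
  shows "emeasure unit_measure ((\<lambda>x. frac (x + c)) -` A) = emeasure unit_measure A"
proof -
  define d where "d = frac c"
  have d: "0 \<le> d" "d < 1" by (simp_all add: d_def frac_lt_1)
  have fr: "frac (x + c) = frac (x + d)" for x :: real
  proof -
    have c: "x + c = (x + d) + of_int \<lfloor>c\<rfloor>" by (simp add: d_def frac_def)
    show ?thesis unfolding c frac_def by simp
  qed
  have tr: "emeasure lborel ((\<lambda>x. e + x) -` B) = emeasure lborel B" if "B \<in> sets borel" for e B
  proof -
    have "emeasure lborel B = emeasure (distr lborel borel ((+) e)) B"
      by (simp add: lborel_distr_plus)
    also have "\<dots> = emeasure lborel ((\<lambda>x. e + x) -` B)"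
      using that by (subst emeasure_distr) auto
    finally show ?thesis by simp
  qed
  let ?S1 = "(\<lambda>x. d + x) -` (A \<inter> {d..<1})"
  let ?S2 = "(\<lambda>x. (d - 1) + x) -` (A \<inter> {0..<d})"
  have f1: "frac (x + d) = d + x" if "0 \<le> x" "d + x < 1" for x
    using that d by (simp add: frac_eq add.commute)
  have f2: "frac (x + d) = (d - 1) + x" if "x < 1" "1 \<le> d + x" for x
    using that d by (simp add: frac_unique_iff)
  have eq: "{0..<1} \<inter> (\<lambda>x. frac (x + c)) -` A = ?S1 \<union> ?S2"
  proof (rule set_eqI)
    fix x
    show "x \<in> {0..<1} \<inter> (\<lambda>x. frac (x + c)) -` A \<longleftrightarrow> x \<in> ?S1 \<union> ?S2"
      using d f1[of x] f2[of x] by (cases "d + x < 1") (auto simp: fr add.commute[of x d])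
  qed
  have vm: "(\<lambda>x. e + x) -` B \<in> sets lborel" if "B \<in> sets borel" for e :: real and B
    using measurable_sets_borel[of "\<lambda>x. e + x" borel B] that by simp
  have "emeasure lborel ({0..<1} \<inter> (\<lambda>x. frac (x + c)) -` A)
      = emeasure lborel ?S1 + emeasure lborel ?S2"
    unfolding eq using A by (intro plus_emeasure[symmetric] vm) auto
  also have "\<dots> = emeasure lborel (A \<inter> {d..<1}) + emeasure lborel (A \<inter> {0..<d})"
    using A by (simp only: tr sets.Int atLeastLessThan_borel)
  also have "\<dots> = emeasure lborel ({0..<1} \<inter> A)"
    using A d by (subst plus_emeasure) (auto intro!: arg_cong[where f = "emeasure lborel"])
  finally show ?thesis
    using A measurable_sets_borel[OF measurable_frac_shift A]
    by (simp add: unit_measure_def)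
qed

definition angle_measure :: "('n::finite \<Rightarrow> real) measure" where
  "angle_measure = PiM UNIV (\<lambda>_. unit_measure)"

lemma sets_angle_measure [measurable_cong]:
  "sets (angle_measure :: ('n::finite \<Rightarrow> real) measure) = sets borel"
proof -
  have "sets angle_measure = sets (PiM UNIV (\<lambda>_::'n. borel :: real measure))"
    unfolding angle_measure_def by (intro sets_PiM_cong) auto
  then show ?thesis by (simp add: sets_PiM_equal_borel)
qed

lemma measurable_angle_shift:
  "(\<lambda>\<theta> i. frac (\<theta> i + c i)) \<in> angle_measure \<rightarrow>\<^sub>M angle_measure"
  unfolding angle_measure_def
proof (rule measurable_PiM_single')
  fix i
  show "(\<lambda>\<theta>. frac (\<theta> i + c i)) \<in> PiM UNIV (\<lambda>_. unit_measure) \<rightarrow>\<^sub>M unit_measure"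
    using measurable_compose[OF measurable_component_singleton[of i UNIV "\<lambda>_. unit_measure"],
        of "\<lambda>x. frac (x + c i)" unit_measure] measurable_frac_shift[of "c i"]
    by (simp cong: measurable_cong_sets)
qed (auto simp: unit_measure_def)

lemma angle_measure_shift:
  fixes c :: "'n::finite \<Rightarrow> real"
  shows "distr angle_measure angle_measure (\<lambda>\<theta> i. frac (\<theta> i + c i)) = angle_measure"
proof -
  interpret U: prob_space unit_measure by (rule prob_space_unit_measure)
  interpret P: product_sigma_finite "\<lambda>_::'n. unit_measure" ..
  have "distr angle_measure angle_measure (\<lambda>\<theta> i. frac (\<theta> i + c i)) = PiM UNIV (\<lambda>_. unit_measure)"
  proof (rule P.PiM_eqI)
    fix A :: "'n \<Rightarrow> real set" assume A: "\<And>i. i \<in> UNIV \<Longrightarrow> A i \<in> sets unit_measure"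
    have "emeasure (distr angle_measure angle_measure (\<lambda>\<theta> i. frac (\<theta> i + c i))) (Pi\<^sub>E UNIV A)
       = emeasure angle_measure
           ((\<lambda>\<theta> i. frac (\<theta> i + c i)) -` Pi\<^sub>E UNIV A \<inter> space angle_measure)"
      using A by (intro emeasure_distr measurable_angle_shift)
        (auto simp: angle_measure_def intro!: sets_PiM_I_finite)
    also have "(\<lambda>\<theta> i. frac (\<theta> i + c i)) -` Pi\<^sub>E UNIV A \<inter> space angle_measure
       = Pi\<^sub>E UNIV (\<lambda>i. (\<lambda>x. frac (x + c i)) -` A i)"
      by (auto simp: angle_measure_def space_PiM unit_measure_def)
    also have "emeasure angle_measure \<dots> = (\<Prod>i\<in>UNIV. emeasure unit_measure (A i))"
      unfolding angle_measure_def using A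
      by (subst P.emeasure_PiM)
        (auto simp: unit_measure_shift intro: measurable_sets_borel[OF measurable_frac_shift])
    finally show "emeasure (distr angle_measure angle_measure (\<lambda>\<theta> i. frac (\<theta> i + c i)))
       (Pi\<^sub>E UNIV A) = (\<Prod>i\<in>UNIV. emeasure unit_measure (A i))" .
  qed (auto simp: angle_measure_def)
  then show ?thesis by (simp add: angle_measure_def)
qed

definition diag_phase :: "('n::finite \<Rightarrow> real) \<Rightarrow> complex^'n^'n" where
  "diag_phase \<theta> = (\<chi> i j. if i = j then cis (2 * pi * \<theta> i) else 0)"

lemma diag_phase_DU: "diag_phase \<theta> \<in> DU"
  by (simp add: DU_iff diagonal_def diag_phase_def)

lemma cis_frac: "cis (2 * pi * frac x) = cis (2 * pi * x)"
proof -
  have "cis (2 * pi * x) = cis (2 * pi * frac x + 2 * pi * of_int \<lfloor>x\<rfloor>)"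
    by (simp add: frac_def algebra_simps)
  also have "\<dots> = cis (2 * pi * frac x)"
    by (subst cis_mult[symmetric]) simp
  finally show ?thesis by simp
qed

lemma measurable_diag_phase:
  "(diag_phase :: ('n::finite \<Rightarrow> real) \<Rightarrow> _) \<in> angle_measure \<rightarrow>\<^sub>M restrict_space borel DU"
proof (rule measurable_restrict_space2)
  have "continuous_on UNIV (\<lambda>\<theta>. if i = j then cis (2 * pi * \<theta> i) else 0)" for i j :: 'n
    by (cases "i = j") (auto intro!: continuous_intros)
  then have "continuous_on UNIV (diag_phase :: ('n \<Rightarrow> real) \<Rightarrow> _)"
    unfolding diag_phase_def by (intro continuous_on_vec_lambda)
  from borel_measurable_continuous_onI[OF this]
  show "(diag_phase :: ('n \<Rightarrow> real) \<Rightarrow> _) \<in> angle_measure \<rightarrow>\<^sub>M borel"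
    by (simp cong: measurable_cong_sets add: sets_angle_measure)
qed (simp add: diag_phase_DU)

lemma ex_is_haar_DU: "\<exists>M :: (complex^'n^'n) measure. is_haar_DU M"
proof
  let ?R = "restrict_space borel DU :: (complex^'n^'n) measure"
  let ?A = "angle_measure :: ('n \<Rightarrow> real) measure"
  let ?M = "distr ?A ?R diag_phase"
  interpret U: prob_space unit_measure by (rule prob_space_unit_measure)
  interpret P: product_prob_space "\<lambda>_::'n. unit_measure" UNIV ..
  have pA: "prob_space ?A"
    unfolding angle_measure_def by (rule P.prob_space_axioms)
  have "distr ?M ?M (\<lambda>V. U ** V) = ?M" if U: "U \<in> DU" for U
  proof -
    have mult: "(\<lambda>V. U ** V) \<in> ?R \<rightarrow>\<^sub>M ?R"
      using measurable_compose[OF measurable_Pair1' measurable_DU_mult, of U] U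
      by (simp add: space_restrict_space)
    define c where "c i = Arg (U $ i $ i) / (2 * pi)" for i
    have c: "U $ i $ i = cis (2 * pi * c i)" for i
      using U rcis_cmod_Arg[of "U $ i $ i"] by (simp add: c_def DU_iff rcis_def)
    have eq: "U ** diag_phase \<theta> = diag_phase (\<lambda>i. frac (\<theta> i + c i))" for \<theta>
      using U diag_phase_DU[of \<theta>]
      by (simp add: diagonal_mult DU_iff vec_eq_iff)
        (simp add: diag_phase_def cis_frac c cis_mult ring_distribs add.commute)
    have "distr ?M ?M (\<lambda>V. U ** V) = distr ?M ?R (\<lambda>V. U ** V)"
      by (rule distr_cong) auto
    also have "\<dots> = distr ?A ?R ((\<lambda>V. U ** V) \<circ> diag_phase)"
      by (rule distr_distr[OF mult measurable_diag_phase])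
    also have "\<dots> = distr ?A ?R (diag_phase \<circ> (\<lambda>\<theta> i. frac (\<theta> i + c i)))"
      by (simp add: o_def eq)
    also have "\<dots> = distr (distr ?A ?A (\<lambda>\<theta> i. frac (\<theta> i + c i))) ?R diag_phase"
      by (rule distr_distr[OF measurable_diag_phase measurable_angle_shift, symmetric])
    finally show ?thesis by (simp add: angle_measure_shift)
  qed
  then show "is_haar_DU ?M"
    using prob_space.prob_space_distr[OF pA measurable_diag_phase]
    by (simp add: is_haar_DU_def)
qed

lemma ex1_haar_DU: "\<exists>!M :: (complex^'n^'n) measure. is_haar_DU M"
  using ex_is_haar_DU is_haar_DU_unique by blast

lemma is_haar_DU_haar_DU: "is_haar_DU haar_DU"
  unfolding haar_DU_def by (rule theI'[OF ex1_haar_DU])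

end

theory Submission
  imports Defs
begin

text \<open>
  For a diagonal unitary \<open>U\<close>, conjugation by \<open>U \<otimes> U\<^sup>\<otimes>\<^sup>t\<close> multiplies the entry \<open>(I, J)\<close> by
  \<open>\<phi>(I) cnj \<phi>(J)\<close>, where \<open>\<phi>(I)\<close> is the product of the phases \<open>U\<^sub>i\<^sub>i\<close> over the sequence \<open>I\<close>.
  Since \<open>\<phi>\<close> is symmetric, multiplicative and unimodular, conjugation preserves permutation
  invariance and commutes with the partial trace; after a partial transpose it becomes conjugation
  by another diagonal unitary, in which the phases at \<open>B[s]\<close> are conjugated, so positivity
  survives too. Certificates are thus carried to certificates, and all certificate conditions are
  preserved under averaging. Both projections are averages over diagonal unitaries: with respect to
  the Haar measure, and with respect to the uniform measure on the sign matrices.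
\<close>

section \<open>Conjugation by diagonal unitaries\<close>

text \<open>The diagonal of the tensor powers of \<open>U\<close>. Allowing lists of any length lets
  it be evaluated on blocks such as the indices of \<open>B[s]\<close> or the traced-out
  tail.\<close>

definition phase :: "complex^'n^'n \<Rightarrow> 'n list \<Rightarrow> complex" where
  "phase U I = prod_list (map (\<lambda>i. U $ i $ i) I)"

lemma phase_Nil [simp]: "phase U [] = 1"
  by (simp add: phase_def)

lemma phase_Cons [simp]: "phase U (i # I) = U $ i $ i * phase U I"
  by (simp add: phase_def)

lemma phase_append [simp]: "phase U (I @ J) = phase U I * phase U J"
  by (simp add: phase_def)

lemma phase_permute_list:
  assumes "\<sigma> permutes {..<length I}"
  shows "phase U (permute_list \<sigma> I) = phase U I"
proof -
  \<comment> \<open>The product depends only on the multiset of indices, and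
    \<open>permute_list\<close> leaves that multiset unchanged.\<close>
  have "prod_mset (mset (map (\<lambda>i. U $ i $ i) (permute_list \<sigma> I)))
      = prod_mset (mset (map (\<lambda>i. U $ i $ i) I))"
    using assms by simp
  then show ?thesis
    by (simp only: phase_def prod_mset_prod_list)
qed

lemma norm_phase: "U \<in> DU \<Longrightarrow> cmod (phase U I) = 1"
  by (induction I) (simp_all add: DU_iff norm_mult)

lemma phase_cnj: "U \<in> DU \<Longrightarrow> phase U I * cnj (phase U I) = 1"
  using complex_norm_square[of "phase U I"] by (simp add: norm_phase)

lemma phase_eq_prod: "I \<in> seqs t \<Longrightarrow> phase U I = (\<Prod>k\<le>t. U $ (I ! k) $ (I ! k))"
  by (simp add: phase_def prod.list_conv_set_nth seqs_def atLeast0LessThan lessThan_Suc_atMost)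

lemma finite_seqs: "finite (seqs t :: 'n::finite list set)"
  using finite_lists_length_eq[of "UNIV :: 'n set" "Suc t"] by (simp add: seqs_def)

lemma tensor_pow_diagonal:
  assumes "diagonal U" "I \<in> seqs t" "J \<in> seqs t"
  shows "tensor_pow t U I J = (if I = J then phase U I else 0)"
proof (cases "I = J")
  case False
  \<comment> \<open>Distinct sequences of equal length differ at some position, and there the tensor
    product has an off-diagonal factor of \<open>U\<close>, which is zero.\<close>
  with assms obtain k where "k \<le> t" "I ! k \<noteq> J ! k"
    by (auto simp: seqs_def list_eq_iff_nth_eq less_Suc_eq_le)
  then have "\<exists>k\<in>{..t}. U $ (I ! k) $ (J ! k) = 0"
    using assms by (auto simp: diagonal_def)
  then show ?thesis
    using False assms by (simp add: tensor_pow_def)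
qed (use assms in \<open>simp add: tensor_pow_def phase_eq_prod\<close>)

text \<open>Both outer factors are diagonal by \<open>tensor_pow_diagonal\<close>, so each matrix
  product collapses to a single summand.\<close>

lemma local_conj_diagonal:
  fixes U :: "complex^'n::finite^'n"
  assumes "diagonal U" "I \<in> seqs t" "J \<in> seqs t"
  shows "local_conj t U \<rho> I J = phase U I * \<rho> I J * cnj (phase U J)"
proof -
  have left: "seqmat_mult t (tensor_pow t U) \<rho> I K = phase U I * \<rho> I K" for K
  proof -
    have "seqmat_mult t (tensor_pow t U) \<rho> I K
        = (\<Sum>L\<in>seqs t. if L = I then phase U I * \<rho> I K else 0)"
      unfolding seqmat_mult_def
      by (rule sum.cong) (use assms in \<open>auto simp: tensor_pow_diagonal\<close>)
    then show ?thesis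
      using assms by (simp add: finite_seqs)
  qed
  have "local_conj t U \<rho> I J
      = (\<Sum>K\<in>seqs t. phase U I * \<rho> I K * cnj (tensor_pow t U J K))"
    unfolding local_conj_def seqmat_mult_def[of _ "seqmat_mult t (tensor_pow t U) \<rho>"]
    by (simp add: left seqmat_adjoint_def)
  also have "\<dots> = (\<Sum>K\<in>seqs t. if K = J then phase U I * \<rho> I J * cnj (phase U J) else 0)"
    by (rule sum.cong) (use assms in \<open>auto simp: tensor_pow_diagonal\<close>)
  also have "\<dots> = phase U I * \<rho> I J * cnj (phase U J)"
    using assms by (simp add: finite_seqs)
  finally show ?thesis .
qed

lemma local_conj_outside:
  assumes "\<not> (I \<in> seqs t \<and> J \<in> seqs t)"
  shows "local_conj t U \<rho> I J = 0"
  using assms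
  by (auto simp: local_conj_def seqmat_mult_def seqmat_adjoint_def tensor_pow_def)

section \<open>Certificate conditions under a single conjugation\<close>

lemma local_conj_Herm:
  fixes U :: "complex^'n::finite^'n"
  assumes "U \<in> DU" "\<rho> \<in> Herm t"
  shows "local_conj t U \<rho> \<in> Herm t"
proof -
  have "seqmat_adjoint \<rho> I J = \<rho> I J" for I J
    using assms(2) by (simp add: Herm_def)
  then have "cnj (\<rho> J I) = \<rho> I J" for I J
    by (simp add: seqmat_adjoint_def)
  then have "cnj (local_conj t U \<rho> J I) = local_conj t U \<rho> I J" for I J
    using assms(1)
    by (cases "I \<in> seqs t \<and> J \<in> seqs t")
      (auto simp: DU_iff local_conj_diagonal local_conj_outside)
  then show ?thesis
    by (auto simp: Herm_def seqmat_def seqmat_adjoint_def local_conj_outside)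
qed

text \<open>Here B = D A D* with D the diagonal matrix of \<psi>. The weights are arbitrary because
  the ones arising after a partial transpose are not of the form \<open>phase U\<close>.\<close>

lemma psd_diagonal_congruence:
  assumes "psd t A" "B \<in> seqmat t"
    and B: "\<And>I J. I \<in> seqs t \<Longrightarrow> J \<in> seqs t \<Longrightarrow> B I J = \<psi> I * A I J * cnj (\<psi> J)"
  shows "psd t B"
proof -
  have "seqmat_adjoint A I J = A I J" for I J
    using assms(1) by (simp add: psd_def Herm_def)
  then have A: "cnj (A J I) = A I J" for I J
    by (simp add: seqmat_adjoint_def)
  have "cnj (B J I) = B I J" for I J
    by (cases "I \<in> seqs t \<and> J \<in> seqs t") (use assms(2) in \<open>auto simp: A B seqmat_def\<close>)
  then have "B \<in> Herm t"
    using assms(2) by (simp add: Herm_def seqmat_adjoint_def)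
  moreover have "0 \<le> Re (\<Sum>I\<in>seqs t. \<Sum>J\<in>seqs t. cnj (x I) * B I J * x J)" for x
  proof -
    \<comment> \<open>This is y = D* x: the quadratic form of \<open>B\<close> at \<open>x\<close>
      is that of \<open>A\<close> at \<open>y\<close>.\<close>
    define y where "y I = cnj (\<psi> I) * x I" for I
    have "(\<Sum>I\<in>seqs t. \<Sum>J\<in>seqs t. cnj (x I) * B I J * x J)
        = (\<Sum>I\<in>seqs t. \<Sum>J\<in>seqs t. cnj (y I) * A I J * y J)"
      by (intro sum.cong refl) (simp add: B y_def mult_ac)
    then show ?thesis
      using assms(1) by (simp add: psd_def)
  qed
  ultimately show ?thesis
    by (simp add: psd_def)
qed

lemma psd_partial_transpose_local_conj:
  fixes U :: "complex^'n::finite^'n"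
  assumes "U \<in> DU" "psd t (partial_transpose t s \<rho>)"
  shows "psd t (partial_transpose t s (local_conj t U \<rho>))"
proof (rule psd_diagonal_congruence[OF assms(2)])
  show "partial_transpose t s (local_conj t U \<rho>) \<in> seqmat t"
    by (auto simp: seqmat_def partial_transpose_def)
next
  fix I J :: "'n list"
  assume IJ: "I \<in> seqs t" "J \<in> seqs t"
  then have "hd I # take s (tl J) @ drop s (tl I) \<in> seqs t"
    "hd J # take s (tl I) @ drop s (tl J) \<in> seqs t"
    by (auto simp: seqs_def)
  \<comment> \<open>The transpose moves the first \<open>s\<close> B-indices of \<open>I\<close> to
    the column side, where their phases are conjugated, and those of \<open>J\<close> to the row
    side. Regrouping the factors by \<open>I\<close> and \<open>J\<close> gives the weights of a
    diagonal congruence.\<close>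
  then show "partial_transpose t s (local_conj t U \<rho>) I J
      = (phase U [hd I] * cnj (phase U (take s (tl I))) * phase U (drop s (tl I)))
        * partial_transpose t s \<rho> I J
        * cnj (phase U [hd J] * cnj (phase U (take s (tl J))) * phase U (drop s (tl J)))"
    using assms(1) IJ
    by (simp add: DU_iff partial_transpose_def local_conj_diagonal mult_ac)
qed

text \<open>The traced-out sequence \<open>h\<close> occurs in both the row and the column, so it
  contributes \<open>phase U h\<close> times its conjugate, which is 1.\<close>

lemma partial_trace_local_conj:
  fixes U :: "complex^'n::finite^'n"
  assumes "U \<in> DU" "t \<ge> 1"
  shows "partial_trace t (local_conj t U \<rho>) = local_conj 1 U (partial_trace t \<rho>)"
proof (intro ext)
  fix I J :: "'n list"
  show "partial_trace t (local_conj t U \<rho>) I J = local_conj 1 U (partial_trace t \<rho>) I J"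
  proof (cases "I \<in> seqs 1 \<and> J \<in> seqs 1")
    case True
    have "local_conj t U \<rho> (I @ h) (J @ h) = phase U I * \<rho> (I @ h) (J @ h) * cnj (phase U J)"
      if "length h = t - 1" for h
    proof -
      \<comment> \<open>The length is 2 + (t - 1), which equals t + 1 in truncated subtraction
        because t \<ge> 1.\<close>
      have "I @ h \<in> seqs t" "J @ h \<in> seqs t"
        using True that assms(2) by (auto simp: seqs_def)
      then have "local_conj t U \<rho> (I @ h) (J @ h)
          = phase U I * \<rho> (I @ h) (J @ h) * cnj (phase U J) * (phase U h * cnj (phase U h))"
        using assms(1) by (simp add: DU_iff local_conj_diagonal mult_ac)
      then show ?thesis
        by (simp add: phase_cnj[OF assms(1)])
    qed
    then have "partial_trace t (local_conj t U \<rho>) I J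
        = (\<Sum>h | length h = t - 1. phase U I * \<rho> (I @ h) (J @ h) * cnj (phase U J))"
      using True by (simp add: partial_trace_def)
    then show ?thesis
      using True assms(1)
      by (simp add: DU_iff local_conj_diagonal partial_trace_def sum_distrib_left sum_distrib_right)
  qed (auto simp: local_conj_outside partial_trace_def)
qed

lemma DPS_certificate_local_conj:
  fixes U :: "complex^'n::finite^'n"
  assumes "U \<in> DU" "t \<ge> 1" "DPS_certificate t \<rho>AB \<rho>"
  shows "DPS_certificate t (local_conj 1 U \<rho>AB) (local_conj t U \<rho>)"
proof -
  have "local_conj t U \<rho> (i0 # is) (j0 # js) = local_conj t U \<rho> (i0 # is) (j0 # permute_list \<sigma> js)"
    if "\<sigma> permutes {..<t}" "length is = t" "length js = t" for \<sigma> i0 j0 "is" js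
  proof -
    have "\<rho> (i0 # is) (j0 # js) = \<rho> (i0 # is) (j0 # permute_list \<sigma> js)"
      using assms(3) that unfolding DPS_certificate_def by blast
    then show ?thesis
      using assms(1) that
      by (simp add: DU_iff local_conj_diagonal seqs_def phase_permute_list)
  qed
  moreover have "local_conj 1 U \<rho>AB \<in> Herm 1" "local_conj t U \<rho> \<in> Herm t"
    "\<And>s. s \<le> t \<Longrightarrow> psd t (partial_transpose t s (local_conj t U \<rho>))"
    using assms unfolding DPS_certificate_def
    by (blast intro: local_conj_Herm psd_partial_transpose_local_conj)+
  moreover have "partial_trace t (local_conj t U \<rho>) = local_conj 1 U \<rho>AB"
    using assms by (simp add: partial_trace_local_conj DPS_certificate_def)
  ultimately show ?thesis
    unfolding DPS_certificate_def by blast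
qed

section \<open>Averaging certificates\<close>

text \<open>Conjugation always passes through the Bochner integral, a nonintegrable function having
  integral 0 by convention. The lemma thus applies to the averaged \<open>A\<close> in
  \<open>DPS_certificate_integral\<close>, where integrability is assumed for
  \<open>R\<close>.\<close>

lemma Herm_integral:
  assumes "\<And>U. U \<in> space M \<Longrightarrow> A U \<in> Herm t"
  shows "(\<lambda>I J. \<integral>U. A U I J \<partial>M) \<in> Herm t"
proof -
  have "(\<integral>U. A U I J \<partial>M) = 0" if "\<not> (I \<in> seqs t \<and> J \<in> seqs t)" for I J
  proof -
    have "(\<integral>U. A U I J \<partial>M) = (\<integral>U. 0 \<partial>M)"
      using assms that
      by (intro Bochner_Integration.integral_cong) (auto simp: Herm_def seqmat_def)
    then show ?thesis by simp
  qed
  moreover have "cnj (\<integral>U. A U J I \<partial>M) = (\<integral>U. A U I J \<partial>M)" for I J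
  proof -
    have "(\<integral>U. cnj (A U J I) \<partial>M) = (\<integral>U. A U I J \<partial>M)"
    proof (rule Bochner_Integration.integral_cong[OF refl])
      fix U assume "U \<in> space M"
      then have "seqmat_adjoint (A U) I J = A U I J"
        using assms by (simp add: Herm_def)
      then show "cnj (A U J I) = A U I J"
        by (simp add: seqmat_adjoint_def)
    qed
    then show ?thesis by simp
  qed
  ultimately show ?thesis
    by (simp add: Herm_def seqmat_def seqmat_adjoint_def)
qed

text \<open>The quadratic form at a fixed vector is linear in the matrix, so its value at the
  average is the integral of nonnegative values.\<close>

lemma psd_integral:
  fixes A :: "'a \<Rightarrow> 'n::finite seqmat"
  assumes int: "\<And>I J. integrable M (\<lambda>U. A U I J)"
    and psd: "\<And>U. U \<in> space M \<Longrightarrow> psd t (A U)"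
  shows "psd t (\<lambda>I J. \<integral>U. A U I J \<partial>M)"
proof -
  have "0 \<le> Re (\<Sum>I\<in>seqs t. \<Sum>J\<in>seqs t. cnj (x I) * (\<integral>U. A U I J \<partial>M) * x J)" for x
  proof -
    have "(\<Sum>I\<in>seqs t. \<Sum>J\<in>seqs t. cnj (x I) * (\<integral>U. A U I J \<partial>M) * x J)
        = (\<integral>U. (\<Sum>I\<in>seqs t. \<Sum>J\<in>seqs t. cnj (x I) * A U I J * x J) \<partial>M)"
      using int by (simp add: Bochner_Integration.integral_sum)
    also have "Re \<dots> = (\<integral>U. Re (\<Sum>I\<in>seqs t. \<Sum>J\<in>seqs t. cnj (x I) * A U I J * x J) \<partial>M)"
      using int by (intro integral_Re[symmetric]) auto
    also have "\<dots> \<ge> 0"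
      using psd by (intro Bochner_Integration.integral_nonneg) (auto simp: psd_def)
    finally show ?thesis .
  qed
  then show ?thesis
    using psd by (auto simp: psd_def intro!: Herm_integral)
qed

text \<open>Every condition is either a linear identity between finitely many entries or membership
  in a convex cone.\<close>

lemma DPS_certificate_integral:
  fixes A R :: "'a \<Rightarrow> 'n::finite seqmat"
  assumes int: "\<And>I J. integrable M (\<lambda>U. R U I J)"
    and cert: "\<And>U. U \<in> space M \<Longrightarrow> DPS_certificate t (A U) (R U)"
  shows "DPS_certificate t (\<lambda>I J. \<integral>U. A U I J \<partial>M) (\<lambda>I J. \<integral>U. R U I J \<partial>M)"
proof -
  let ?R = "\<lambda>I J. \<integral>U. R U I J \<partial>M"
  have "(\<lambda>I J. \<integral>U. A U I J \<partial>M) \<in> Herm 1" "?R \<in> Herm t"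
    using cert unfolding DPS_certificate_def by (blast intro: Herm_integral)+
  moreover have "?R (i0 # is) (j0 # js) = ?R (i0 # is) (j0 # permute_list \<sigma> js)"
    if "\<sigma> permutes {..<t}" "length is = t" "length js = t" for \<sigma> i0 j0 "is" js
    by (rule Bochner_Integration.integral_cong[OF refl])
      (use cert that in \<open>unfold DPS_certificate_def, blast\<close>)
  moreover have "psd t (partial_transpose t s ?R)" if "s \<le> t" for s
  proof -
    \<comment> \<open>Partial transposition only relocates entries, so it commutes with entrywise
      integration.\<close>
    have "partial_transpose t s ?R = (\<lambda>I J. \<integral>U. partial_transpose t s (R U) I J \<partial>M)"
      by (auto simp: partial_transpose_def intro!: ext)
    moreover have "psd t \<dots>"
    proof (rule psd_integral)
      show "integrable M (\<lambda>U. partial_transpose t s (R U) I J)" for I J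
        using int by (cases "I \<in> seqs t \<and> J \<in> seqs t") (auto simp: partial_transpose_def)
      show "psd t (partial_transpose t s (R U))" if "U \<in> space M" for U
        using cert[OF that] \<open>s \<le> t\<close> unfolding DPS_certificate_def by blast
    qed
    ultimately show ?thesis
      by simp
  qed
  moreover have "partial_trace t ?R = (\<lambda>I J. \<integral>U. A U I J \<partial>M)"
  proof (intro ext)
    fix I J
    have "partial_trace t ?R I J = (\<integral>U. partial_trace t (R U) I J \<partial>M)"
      using int
      by (cases "I \<in> seqs 1 \<and> J \<in> seqs 1")
        (auto simp: partial_trace_def Bochner_Integration.integral_sum)
    also have "\<dots> = (\<integral>U. A U I J \<partial>M)"
      using cert by (intro Bochner_Integration.integral_cong) (simp_all add: DPS_certificate_def)
    finally show "partial_trace t ?R I J = (\<integral>U. A U I J \<partial>M)" .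
  qed
  ultimately show ?thesis
    unfolding DPS_certificate_def by blast
qed

text \<open>Stated for a general measure carried by diagonal unitaries so that one argument serves
  both projections.\<close>

lemma DPS_certificate_twirl:
  fixes \<rho>AB \<rho> :: "'n::finite seqmat"
  assumes "\<And>I J. integrable M (\<lambda>U. local_conj t U \<rho> I J)" "space M \<subseteq> DU"
    and "t \<ge> 1" "DPS_certificate t \<rho>AB \<rho>"
  shows "DPS_certificate t (\<lambda>I J. \<integral>U. local_conj 1 U \<rho>AB I J \<partial>M)
    (\<lambda>I J. \<integral>U. local_conj t U \<rho> I J \<partial>M)"
  using assms by (intro DPS_certificate_integral DPS_certificate_local_conj) auto

lemma DPS_I: "DPS_certificate t \<rho>AB \<rho> \<Longrightarrow> \<rho>AB \<in> DPS t"
  unfolding DPS_def DPS_certificate_def by blast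

section \<open>The two projections\<close>

lemma space_haar_DU: "space haar_DU = DU"
  using is_haar_DU_haar_DU sets_eq_imp_space_eq[of haar_DU "restrict_space borel DU"]
  by (auto simp: is_haar_DU_def space_restrict_space)

text \<open>On \<open>DU\<close> the entry is a continuous function of \<open>U\<close> of modulus
  at most \<open>cmod (\<rho> I J)\<close>, and the measure is finite.\<close>

lemma integrable_haar_local_conj:
  fixes \<rho> :: "'n::finite seqmat"
  shows "integrable haar_DU (\<lambda>U. local_conj t U \<rho> I J)"
proof (cases "I \<in> seqs t \<and> J \<in> seqs t")
  case True
  have haar: "prob_space haar_DU"
    "sets haar_DU = sets (restrict_space borel DU :: (complex^'n^'n) measure)"
    using is_haar_DU_haar_DU by (auto simp: is_haar_DU_def)
  interpret prob_space "haar_DU :: (complex^'n^'n) measure"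
    by (rule haar)
  have eq: "local_conj t U \<rho> I J = phase U I * \<rho> I J * cnj (phase U J)"
    if "U \<in> space haar_DU" for U
    using True that by (auto simp: space_haar_DU DU_iff local_conj_diagonal)
  \<comment> \<open>Measurability is shown for the phase formula, which is continuous on all
    matrices; it agrees with \<open>local_conj\<close> on the sample space by
    \<open>eq\<close>.\<close>
  have "continuous_on UNIV (\<lambda>U :: complex^'n^'n. phase U K)" for K
    by (induction K) (auto intro!: continuous_intros)
  then have "(\<lambda>U. phase U I * \<rho> I J * cnj (phase U J)) \<in> borel_measurable borel"
    by (intro borel_measurable_continuous_onI continuous_intros)
  then have "(\<lambda>U. phase U I * \<rho> I J * cnj (phase U J)) \<in> borel_measurable haar_DU"
    using haar(2) by (simp add: measurable_restrict_space1 cong: measurable_cong_sets)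
  moreover have "AE U in haar_DU. cmod (phase U I * \<rho> I J * cnj (phase U J)) \<le> cmod (\<rho> I J)"
    by (intro AE_I2) (simp add: space_haar_DU norm_mult norm_phase)
  ultimately have "integrable haar_DU (\<lambda>U. phase U I * \<rho> I J * cnj (phase U J))"
    by (intro integrable_const_bound)
  then show ?thesis
    using eq by (simp cong: Bochner_Integration.integrable_cong)
qed (simp add: local_conj_outside)

section \<open>The uniform measure on the sign matrices\<close>

lemma DO_eq_image:
  "(DO :: (complex^'n::finite^'n) set)
    = (\<lambda>e. \<chi> i j. if i = j then e i else 0) ` (UNIV \<rightarrow> {1, -1})"
proof (intro equalityI subsetI)
  fix U :: "complex^'n^'n"
  assume "U \<in> DO"
  then have "U = (\<chi> i j. if i = j then U $ i $ i else 0)" "(\<lambda>i. U $ i $ i) \<in> UNIV \<rightarrow> {1, -1}"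
    by (auto simp: DO_def diagonal_def vec_eq_iff)
  then show "U \<in> (\<lambda>e. \<chi> i j. if i = j then e i else 0) ` (UNIV \<rightarrow> {1, -1})"
    by (intro image_eqI[where x = "\<lambda>i. U $ i $ i"])
qed (auto simp: DO_def diagonal_def)

text \<open>Sign matrices correspond bijectively to sign vectors. The count identifies the factor in
  \<open>proj_LDOI\<close> with the weight of each point under the uniform probability
  measure.\<close>

lemma finite_DO: "finite (DO :: (complex^'n::finite^'n) set)"
  and card_DO: "card (DO :: (complex^'n::finite^'n) set) = 2 ^ CARD('n)"
proof -
  have inj: "inj_on (\<lambda>e :: 'n \<Rightarrow> complex. \<chi> i j. if i = j then e i else 0) X" for X
    by (rule inj_onI) (simp add: vec_eq_iff fun_eq_iff, metis)
  have "finite (UNIV \<rightarrow>\<^sub>E {1, -1} :: ('n \<Rightarrow> complex) set)"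
    by (intro finite_PiE) auto
  then show "finite (DO :: (complex^'n^'n) set)"
    by (simp add: DO_eq_image PiE_UNIV_domain)
  have "card (DO :: (complex^'n^'n) set) = card (UNIV \<rightarrow>\<^sub>E {1, -1} :: ('n \<Rightarrow> complex) set)"
    by (simp add: DO_eq_image card_image[OF inj] PiE_UNIV_domain)
  also have "\<dots> = 2 ^ CARD('n)"
    by (subst card_PiE) (auto simp: card_insert_if numeral_2_eq_2)
  finally show "card (DO :: (complex^'n^'n) set) = 2 ^ CARD('n)" .
qed

lemma DO_subset_DU: "DO \<subseteq> DU"
proof
  fix U :: "complex^'n^'n"
  assume U: "U \<in> DO"
  have "cmod (U $ i $ i) = 1" for i
  proof -
    have "U $ i $ i = 1 \<or> U $ i $ i = -1"
      using U by (auto simp: DO_def)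
    then show ?thesis by auto
  qed
  then show "U \<in> DU"
    using U by (simp add: DO_def DU_iff)
qed

text \<open>Puts the finite average into the integral form that \<open>DPS_certificate_twirl\<close>
  expects.\<close>

lemma proj_LDOI_eq_integral:
  fixes \<rho> :: "'n::finite seqmat"
  shows "proj_LDOI t \<rho> = (\<lambda>I J. \<integral>U. local_conj t U \<rho> I J \<partial>uniform_count_measure DO)"
proof (intro ext)
  fix I J :: "'n list"
  have "(\<integral>U. local_conj t U \<rho> I J \<partial>uniform_count_measure DO)
      = (\<Sum>U\<in>DO. (1 / real (card (DO :: (complex^'n^'n) set))) *\<^sub>R local_conj t U \<rho> I J)"
    unfolding uniform_count_measure_def
    by (rule lebesgue_integral_point_measure_finite) (simp_all add: finite_DO)
  then show "proj_LDOI t \<rho> I J = (\<integral>U. local_conj t U \<rho> I J \<partial>uniform_count_measure DO)"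
    by (simp add: proj_LDOI_def card_DO scaleR_conv_of_real sum_distrib_left)
qed

theorem theorem3p10:
  fixes t :: nat and \<rho>AB \<rho>ABt :: "'n::finite seqmat"
  assumes "t \<ge> 1"
    and "\<rho>AB \<in> DPS t"
    and "DPS_certificate t \<rho>AB \<rho>ABt"
  shows "(proj_LDUI 1 \<rho>AB \<in> DPS t \<and>
          DPS_certificate t (proj_LDUI 1 \<rho>AB) (proj_LDUI t \<rho>ABt)) \<and>
         (proj_LDOI 1 \<rho>AB \<in> DPS t \<and>
          DPS_certificate t (proj_LDOI 1 \<rho>AB) (proj_LDOI t \<rho>ABt))"
proof -
  have "DPS_certificate t (proj_LDUI 1 \<rho>AB) (proj_LDUI t \<rho>ABt)"
    unfolding proj_LDUI_def
    using assms by (intro DPS_certificate_twirl integrable_haar_local_conj) (simp_all add: space_haar_DU)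
  moreover have "DPS_certificate t (proj_LDOI 1 \<rho>AB) (proj_LDOI t \<rho>ABt)"
    unfolding proj_LDOI_eq_integral
  proof (rule DPS_certificate_twirl)
    show "integrable (uniform_count_measure DO) (\<lambda>U. local_conj t U \<rho>ABt I J)" for I J
      unfolding uniform_count_measure_def
      by (rule integrable_point_measure_finite) (simp add: finite_DO)
  qed (use assms DO_subset_DU in \<open>simp_all add: space_uniform_count_measure\<close>)
  ultimately show ?thesis
    using DPS_I by blast
qed

end
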